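(* Let $\mathbf{v}_i=[v_{i,j}:j\in\mathbb{N}]$, $i=1,\dots,n$, be linearly independent elements of $c_0(\mathbb{N})$, let $\mathbf{y}_0\in\mathbb{R}^n$ and $\lambda>0$, and put $\mathcal{V}:=\mathrm{span}\{\mathbf{v}_1,\dots,\mathbf{v}_n\}$. Let $\mathcal{Q}_{\mathbf{y}_0}:\mathbb{R}^n\to[0,+\infty)$ be lower semi-continuous and convex, and let $\mathrm{R}(\mathbf{y}_0)$ be the set of solutions of $$\inf\{\mathcal{Q}_{\mathbf{y}_0}(\mathbf{V}\mathbf{x})+\lambda\|\mathbf{x}\|_1:\mathbf{x}\in\ell_1(\mathbb{N})\},\qquad \mathbf{V}\mathbf{x}:=\Bigl[\sum_{j\in\mathbb{N}}v_{i,j}x_j\Bigr]_{i=1}^n .$$ Then every nonzero extreme point $\hat{\mathbf{x}}$ of $\mathrm{R}(\mathbf{y}_0)$ has the form $$\hat{\mathbf{x}}=\sum_{j=1}^M\alpha_jK(\cdot,k_j)$$ for some nonzero $\hat{\mathbf{v}}\in\mathcal{V}$, some positive integer $M\le\mathrm{rank}(\mathbf{V}_{\hat{\mathbf{v}}})$, some $\alpha_j\neq0$, $j=1,\dots,M$, with $\sum_{j=1}^M|\alpha_j|=\|\hat{\mathbf{v}}\|_\infty$, and some $k_j\in\mathbb{N}(\hat{\mathbf{v}})$, $j=1,\dots,M$.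
   Context: $\ell_1(\mathbb{N})$ is the space of absolutely summable real sequences with norm $\|\cdot\|_1$; $c_0(\mathbb{N})$ is the space of real sequences converging to $0$ with norm $\|\cdot\|_\infty$. $K:\mathbb{N}\times\mathbb{N}\to\mathbb{R}$ is $K(i,j)=1$ if $i=j$ and $0$ otherwise, so $K(\cdot,j)$ is the $j$-th unit sequence. For nonzero $\mathbf{v}=[v_j:j\in\mathbb{N}]\in c_0(\mathbb{N})$: $\mathbb{N}(\mathbf{v}):=\{j\in\mathbb{N}:|v_j|=\|\mathbf{v}\|_\infty\}$ (a finite set), $n(\mathbf{v})$ is its cardinality and, writing $\mathbb{N}(\mathbf{v})=\{m_1,\dots,m_{n(\mathbf{v})}\}$, $\mathbf{V}_{\mathbf{v}}:=[v_{i,m_j}]_{1\le i\le n,\,1\le j\le n(\mathbf{v})}\in\mathbb{R}^{n\times n(\mathbf{v})}$. *)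

theory Defs
  imports "HOL-Analysis.Analysis" "HOL-Library.Function_Algebras"
begin

(* Sequences form a real vector space under the pointwise operations; this makes span, dependent
   and extreme_point_of available for them. *)

instantiation "fun" :: (type, real_vector) real_vector
begin

definition scaleR_fun :: "real \<Rightarrow> ('a \<Rightarrow> 'b) \<Rightarrow> 'a \<Rightarrow> 'b"
  where "scaleR_fun c f = (\<lambda>x. c *\<^sub>R f x)"

instance
  by standard (simp_all add: scaleR_fun_def fun_eq_iff scaleR_add_right scaleR_add_left)

end

definition l1_space :: "(nat \<Rightarrow> real) set"
  where "l1_space = {x. summable (\<lambda>j. \<bar>x j\<bar>)}"

definition l1_norm :: "(nat \<Rightarrow> real) \<Rightarrow> real"
  where "l1_norm x = (\<Sum>j. \<bar>x j\<bar>)"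

definition c0_space :: "(nat \<Rightarrow> real) set"
  where "c0_space = {v. v \<longlonglongrightarrow> 0}"

definition sup_norm :: "(nat \<Rightarrow> real) \<Rightarrow> real"
  where "sup_norm v = (SUP j. \<bar>v j\<bar>)"

definition K :: "nat \<Rightarrow> nat \<Rightarrow> real"
  where "K i j = (if i = j then 1 else 0)"

definition peak_set :: "(nat \<Rightarrow> real) \<Rightarrow> nat set"
  where "peak_set v = {j. \<bar>v j\<bar> = sup_norm v}"

lemma finite_peak_set:
  assumes "v \<in> c0_space" "v \<noteq> 0"
  shows "finite (peak_set v)"
proof -
  have lim: "v \<longlonglongrightarrow> 0" using assms(1) by (simp add: c0_space_def)
  obtain k where k: "v k \<noteq> 0" using assms(2) by (auto simp: fun_eq_iff)
  obtain B where "\<And>j. norm (v j) \<le> B"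
    using convergent_imp_Bseq[OF convergentI[OF lim]] by (elim BseqE) blast
  then have "bdd_above (range (\<lambda>j. \<bar>v j\<bar>))" by (auto intro!: bdd_aboveI[of _ B])
  then have "\<bar>v k\<bar> \<le> sup_norm v" unfolding sup_norm_def by (rule cSUP_upper[rotated]) simp
  then have "sup_norm v > 0" using k by linarith
  then obtain N where N: "\<And>j. j \<ge> N \<Longrightarrow> \<bar>v j\<bar> < sup_norm v"
    using LIMSEQ_D[OF lim, of "sup_norm v"] by auto
  have "peak_set v \<subseteq> {..<N}"
  proof
    fix j assume "j \<in> peak_set v"
    then have "\<not> \<bar>v j\<bar> < sup_norm v" by (simp add: peak_set_def)
    then show "j \<in> {..<N}" using N[of j] by fastforce
  qed
  then show ?thesis by (rule finite_subset) simp
qed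

definition peak_count :: "(nat \<Rightarrow> real) \<Rightarrow> nat"
  where "peak_count v = card (peak_set v)"

(* The matrix V_u, with rows indexed by 'n and columns by j < peak_count u; column j belongs to
   the (j+1)-st smallest element of peak_set u. The number of columns depends on u, so it cannot
   be a type and V_u is not an element of a type real^'m^'n. *)
definition peak_matrix :: "('n \<Rightarrow> nat \<Rightarrow> real) \<Rightarrow> (nat \<Rightarrow> real) \<Rightarrow> 'n \<Rightarrow> nat \<Rightarrow> real"
  where "peak_matrix v u i j = v i (sorted_list_of_set (peak_set u) ! j)"

(* Rank of a matrix with rows indexed by 'n and columns by j < k, as the dimension of its column
   space; rank_eq_mat_rank relates it to rank on real^'m^'n. *)
definition mat_rank :: "nat \<Rightarrow> ('n::finite \<Rightarrow> nat \<Rightarrow> real) \<Rightarrow> nat"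
  where "mat_rank k A = dim (span ((\<lambda>j. (\<chi> i. A i j) :: real^'n) ` {..<k}))"

lemma rank_eq_mat_rank:
  fixes A :: "real^'m^'n"
  assumes "bij_betw f {..<CARD('m)} (UNIV :: 'm set)"
  shows "rank A = mat_rank CARD('m) (\<lambda>i j. A $ i $ f j)"
proof -
  have "columns A = (\<lambda>j. column j A) ` f ` {..<CARD('m)}"
    unfolding bij_betw_imp_surj_on[OF assms] by (auto simp: columns_def)
  then show ?thesis
    by (simp add: column_rank_def mat_rank_def column_def image_image)
qed

definition lower_semicontinuous :: "('a::topological_space \<Rightarrow> real) \<Rightarrow> bool"
  where "lower_semicontinuous f \<longleftrightarrow> (\<forall>x. \<forall>a<f x. eventually (\<lambda>y. a < f y) (nhds x))"

definition V_op :: "('n::finite \<Rightarrow> nat \<Rightarrow> real) \<Rightarrow> (nat \<Rightarrow> real) \<Rightarrow> real^'n"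
  where "V_op v x = (\<chi> i. \<Sum>j. v i j * x j)"

definition solution_set ::
    "('n::finite \<Rightarrow> nat \<Rightarrow> real) \<Rightarrow> (real^'n \<Rightarrow> real) \<Rightarrow> real \<Rightarrow> (nat \<Rightarrow> real) set"
  where "solution_set v Q lam =
    {x. is_arg_min (\<lambda>x. Q (V_op v x) + lam * l1_norm x) (\<lambda>x. x \<in> l1_space) x}"

end

theory Submission
  imports Defs
begin

text \<open>
  The fidelity term sees a sequence only through its image under \<open>V\<close>. So a minimizer \<open>x\<close> has
  \<^emph>\<open>minimal norm\<close>: its \<open>l1\<close> norm \<open>r\<close> is least among all sequences with the same image, and
  every other sequence with the same image and norm is a minimizer too.

  Minimality of the norm says that \<open>V x\<close> lies outside the image under \<open>V\<close> of the open \<open>l1\<close> ball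
  of radius \<open>r\<close>. This image is a convex subset of a Euclidean space, so a nonzero \<open>a\<close> separates it from
  \<open>V x\<close>. Pulled back along \<open>V\<close>, the functional \<open>a\<close> becomes a sequence \<open>u\<close> in the span of the
  rows, nonzero since the rows are independent, that attains its norm at \<open>x\<close>: the pairing of \<open>u\<close>
  and \<open>x\<close> is the product of their norms (\<open>dual_certificate\<close>). We rescale \<open>u\<close> to have sup norm \<open>r\<close>.
  Equality in Hoelder's inequality then forces the support of \<open>x\<close> into the finite peak set
  of \<open>u\<close>, with matching signs (\<open>holder_equality\<close>, \<open>holder_equality_peak\<close>).

  Extremality bounds the size of the support. If the columns of \<open>V\<close> over the support were linearly
  dependent, a small relation \<open>c\<close> among them could be added to and subtracted from \<open>x\<close> without
  changing \<open>V x\<close> or reversing any sign; since \<open>u\<close> is the pull-back of \<open>a\<close> and so annihilates \<open>c\<close>, the norm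
  would not change either (\<open>l1_norm_kernel_perturbation\<close>), and \<open>x\<close> would be the midpoint of two
  other minimizers (\<open>extreme_point_kernel_trivial\<close>). Hence these columns are independent, and their number is at
  most the rank of the peak matrix.
\<close>

section \<open>Summable sequences and null sequences\<close>

lemma l1_space_add: "x \<in> l1_space \<Longrightarrow> y \<in> l1_space \<Longrightarrow> x + y \<in> l1_space"
  unfolding l1_space_def
  by (auto intro: summable_comparison_test'[OF summable_add[of "\<lambda>j. \<bar>x j\<bar>" "\<lambda>j. \<bar>y j\<bar>"], of 0])

lemma l1_space_scaleR: "x \<in> l1_space \<Longrightarrow> c *\<^sub>R x \<in> l1_space"
  by (auto simp: l1_space_def scaleR_fun_def abs_mult intro: summable_mult)

lemma l1_norm_add_le:
  assumes "x \<in> l1_space" "y \<in> l1_space"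
  shows "l1_norm (x + y) \<le> l1_norm x + l1_norm y"
proof -
  have "l1_norm (x + y) \<le> (\<Sum>j. \<bar>x j\<bar> + \<bar>y j\<bar>)"
    unfolding l1_norm_def using assms l1_space_add[OF assms]
    by (intro suminf_le) (auto simp: l1_space_def intro: summable_add)
  also have "\<dots> = l1_norm x + l1_norm y"
    unfolding l1_norm_def using assms by (subst suminf_add) (auto simp: l1_space_def)
  finally show ?thesis .
qed

lemma l1_norm_scaleR:
  assumes "x \<in> l1_space"
  shows "l1_norm (c *\<^sub>R x) = \<bar>c\<bar> * l1_norm x"
  using assms by (simp add: l1_norm_def l1_space_def scaleR_fun_def abs_mult suminf_mult)

lemma l1_norm_pos:
  assumes "x \<in> l1_space" "x \<noteq> 0"
  shows "0 < l1_norm x"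
proof -
  obtain i where "x i \<noteq> 0" using assms(2) by (auto simp: fun_eq_iff)
  then show ?thesis
    unfolding l1_norm_def using assms(1) by (intro suminf_pos2[of _ i]) (auto simp: l1_space_def)
qed

lemma finite_support_l1_space:
  assumes "finite {j. x j \<noteq> (0::real)}"
  shows "x \<in> l1_space"
  unfolding l1_space_def mem_Collect_eq
  by (rule summable_finite[OF assms]) auto

lemma abs_le_sup_norm:
  assumes "u \<in> c0_space"
  shows "\<bar>u j\<bar> \<le> sup_norm u"
proof -
  have "u \<longlonglongrightarrow> 0" using assms by (simp add: c0_space_def)
  then obtain B where "\<And>j. norm (u j) \<le> B"
    using convergent_imp_Bseq[OF convergentI] by (meson BseqE)
  then have "bdd_above (range (\<lambda>j. \<bar>u j\<bar>))" by (auto intro!: bdd_aboveI[of _ B])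
  then show ?thesis unfolding sup_norm_def by (intro cSUP_upper) auto
qed

lemma sup_norm_le: "(\<And>j. \<bar>u j\<bar> \<le> B) \<Longrightarrow> sup_norm u \<le> B"
  unfolding sup_norm_def by (intro cSUP_least) auto

lemma sup_norm_pos:
  assumes "u \<in> c0_space" "u \<noteq> 0"
  shows "0 < sup_norm u"
proof -
  obtain i where "u i \<noteq> 0" using assms(2) by (auto simp: fun_eq_iff)
  then show ?thesis using abs_le_sup_norm[OF assms(1), of i] by linarith
qed

lemma c0_space_scaleR: "u \<in> c0_space \<Longrightarrow> c *\<^sub>R u \<in> c0_space"
  by (auto simp: c0_space_def scaleR_fun_def intro: tendsto_mult_right_zero)

lemma sup_norm_scaleR:
  assumes "u \<in> c0_space" "0 < c"
  shows "sup_norm (c *\<^sub>R u) = c * sup_norm u"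
proof (rule antisym)
  show "sup_norm (c *\<^sub>R u) \<le> c * sup_norm u"
    using assms abs_le_sup_norm[OF assms(1)]
    by (intro sup_norm_le) (simp add: scaleR_fun_def abs_mult)
  have "\<bar>u j\<bar> \<le> sup_norm (c *\<^sub>R u) / c" for j
    using abs_le_sup_norm[OF c0_space_scaleR[OF assms(1)], of c j] assms(2)
    by (simp add: scaleR_fun_def abs_mult field_simps)
  then have "sup_norm u \<le> sup_norm (c *\<^sub>R u) / c" by (rule sup_norm_le)
  then show "c * sup_norm u \<le> sup_norm (c *\<^sub>R u)" using assms(2) by (simp add: field_simps)
qed

section \<open>The pairing of null sequences and summable sequences\<close>

definition pairing :: "(nat \<Rightarrow> real) \<Rightarrow> (nat \<Rightarrow> real) \<Rightarrow> real"
  where "pairing u x = (\<Sum>j. u j * x j)"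

lemma summable_pairing:
  assumes "u \<in> c0_space" "x \<in> l1_space"
  shows "summable (\<lambda>j. u j * x j)"
proof (rule summable_comparison_test'[of "\<lambda>j. sup_norm u * \<bar>x j\<bar>" 0])
  show "summable (\<lambda>j. sup_norm u * \<bar>x j\<bar>)"
    using assms(2) by (auto simp: l1_space_def intro: summable_mult)
  show "norm (u j * x j) \<le> sup_norm u * \<bar>x j\<bar>" for j
    using abs_le_sup_norm[OF assms(1)] by (simp add: abs_mult mult_right_mono)
qed

lemma pairing_add_right:
  assumes "u \<in> c0_space" "x \<in> l1_space" "y \<in> l1_space"
  shows "pairing u (x + y) = pairing u x + pairing u y"
  using suminf_add[OF summable_pairing[OF assms(1,2)] summable_pairing[OF assms(1,3)]]
  by (simp add: pairing_def distrib_left)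

lemma pairing_scaleR_right:
  assumes "u \<in> c0_space" "x \<in> l1_space"
  shows "pairing u (c *\<^sub>R x) = c * pairing u x"
  using suminf_mult[OF summable_pairing[OF assms], of c]
  by (simp add: pairing_def scaleR_fun_def mult.left_commute)

lemma pairing_scaleR_left:
  assumes "u \<in> c0_space" "x \<in> l1_space"
  shows "pairing (c *\<^sub>R u) x = c * pairing u x"
  using suminf_mult[OF summable_pairing[OF assms], of c]
  by (simp add: pairing_def scaleR_fun_def mult.assoc)

lemma pairing_le_norms:
  assumes "u \<in> c0_space" "x \<in> l1_space"
  shows "pairing u x \<le> sup_norm u * l1_norm x"
proof -
  have sx: "summable (\<lambda>j. \<bar>x j\<bar>)" using assms(2) by (simp add: l1_space_def)
  have "u j * x j \<le> sup_norm u * \<bar>x j\<bar>" for j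
    using mult_right_mono[OF abs_le_sup_norm[OF assms(1), of j], of "\<bar>x j\<bar>"]
      abs_ge_self[of "u j * x j"] by (simp add: abs_mult)
  then have "pairing u x \<le> (\<Sum>j. sup_norm u * \<bar>x j\<bar>)"
    unfolding pairing_def by (rule suminf_le[OF _ summable_pairing[OF assms] summable_mult[OF sx]])
  then show ?thesis using suminf_mult[OF sx] by (simp add: l1_norm_def)
qed

text \<open>
  The gap in Hoelder's inequality is a series of nonnegative terms, so it closes only if every term
  vanishes.
\<close>

lemma holder_equality:
  assumes "u \<in> c0_space" "x \<in> l1_space"
  shows "pairing u x = sup_norm u * l1_norm x \<longleftrightarrow> (\<forall>j. u j * x j = sup_norm u * \<bar>x j\<bar>)"
proof -
  have sx: "summable (\<lambda>j. \<bar>x j\<bar>)" using assms(2) by (simp add: l1_space_def)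
  have nonneg: "0 \<le> sup_norm u * \<bar>x j\<bar> - u j * x j" for j
    using mult_right_mono[OF abs_le_sup_norm[OF assms(1), of j], of "\<bar>x j\<bar>"]
      abs_ge_self[of "u j * x j"] by (simp add: abs_mult)
  have "(\<Sum>j. sup_norm u * \<bar>x j\<bar> - u j * x j) = sup_norm u * l1_norm x - pairing u x"
    using suminf_diff[OF summable_mult[OF sx] summable_pairing[OF assms]] suminf_mult[OF sx]
    by (simp add: l1_norm_def pairing_def)
  moreover have "summable (\<lambda>j. sup_norm u * \<bar>x j\<bar> - u j * x j)"
    by (intro summable_diff summable_mult sx summable_pairing assms)
  ultimately have "sup_norm u * l1_norm x - pairing u x = 0 \<longleftrightarrow>
      (\<forall>j. sup_norm u * \<bar>x j\<bar> - u j * x j = 0)"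
    using suminf_eq_zero_iff[of "\<lambda>j. sup_norm u * \<bar>x j\<bar> - u j * x j"] nonneg by metis
  then show ?thesis by (metis eq_iff_diff_eq_0)
qed

corollary holder_equality_peak:
  assumes "u \<in> c0_space" "x \<in> l1_space"
    and "pairing u x = sup_norm u * l1_norm x" and "x j \<noteq> 0"
  shows "j \<in> peak_set u"
proof -
  have "u j * x j = sup_norm u * \<bar>x j\<bar>" using holder_equality[OF assms(1,2)] assms(3) by blast
  then have "\<bar>u j\<bar> * \<bar>x j\<bar> = \<bar>sup_norm u\<bar> * \<bar>x j\<bar>" by (metis abs_mult abs_abs)
  moreover have "0 \<le> sup_norm u" using abs_le_sup_norm[OF assms(1), of j] by linarith
  ultimately show ?thesis using assms(4) by (simp add: peak_set_def)
qed

lemma pairing_finite_support: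
  assumes "finite S" "\<And>j. j \<notin> S \<Longrightarrow> x j = 0"
  shows "pairing u x = (\<Sum>j\<in>S. u j * x j)"
  unfolding pairing_def using assms by (intro suminf_finite) auto

lemma l1_norm_finite_support:
  assumes "finite S" "\<And>j. j \<notin> S \<Longrightarrow> x j = 0"
  shows "l1_norm x = (\<Sum>j\<in>S. \<bar>x j\<bar>)"
  unfolding l1_norm_def using assms by (intro suminf_finite) auto

section \<open>The operator and its adjoint\<close>

lemma V_op_pairing: "V_op v x = (\<chi> i. pairing (v i) x)"
  by (simp add: V_op_def pairing_def)

lemma V_op_add:
  assumes "\<forall>i. v i \<in> c0_space" "x \<in> l1_space" "y \<in> l1_space"
  shows "V_op v (x + y) = V_op v x + V_op v y"
  using assms by (simp add: V_op_pairing vec_eq_iff pairing_add_right)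

lemma V_op_scaleR:
  assumes "\<forall>i. v i \<in> c0_space" "x \<in> l1_space"
  shows "V_op v (c *\<^sub>R x) = c *\<^sub>R V_op v x"
  using assms by (simp add: V_op_pairing vec_eq_iff pairing_scaleR_right)

definition V_adj :: "('n::finite \<Rightarrow> nat \<Rightarrow> real) \<Rightarrow> real^'n \<Rightarrow> nat \<Rightarrow> real"
  where "V_adj v a = (\<lambda>j. \<Sum>i\<in>UNIV. a $ i * v i j)"

lemma sum_scaleR_fun_apply:
  fixes g :: "'i \<Rightarrow> 'a \<Rightarrow> real"
  shows "(\<Sum>i\<in>A. c i *\<^sub>R g i) j = (\<Sum>i\<in>A. c i * g i j)"
  by (induction A rule: infinite_finite_induct) (auto simp: scaleR_fun_def)

lemma V_adj_eq_sum: "V_adj v a = (\<Sum>i\<in>UNIV. a $ i *\<^sub>R v i)"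
  by (rule ext) (simp add: V_adj_def sum_scaleR_fun_apply)

lemma V_adj_in_span: "V_adj v a \<in> span (range v)"
  unfolding V_adj_eq_sum by (intro span_sum span_scale span_base) auto

lemma V_adj_c0_space:
  assumes "\<forall>i. v i \<in> c0_space"
  shows "V_adj v a \<in> c0_space"
  using assms unfolding V_adj_def c0_space_def mem_Collect_eq
  by (intro tendsto_null_sum tendsto_mult_right_zero) auto

lemma V_adj_scaleR: "V_adj v (c *\<^sub>R a) = c *\<^sub>R V_adj v a"
  by (simp add: V_adj_def scaleR_fun_def sum_distrib_left mult.assoc)

lemma V_adj_nonzero:
  assumes "inj v" "independent (range v)" "a \<noteq> 0"
  shows "V_adj v a \<noteq> 0"
proof
  assume zero: "V_adj v a = 0"
  have "(\<Sum>w\<in>range v. a $ inv v w *\<^sub>R w) = (\<Sum>i\<in>UNIV. a $ i *\<^sub>R v i)"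
    using assms(1) by (simp add: sum.reindex)
  then have "(\<Sum>w\<in>range v. a $ inv v w *\<^sub>R w) = 0" using zero by (simp add: V_adj_eq_sum)
  then have "\<forall>w\<in>range v. a $ inv v w = 0"
    using assms(2) dependent_finite[of "range v"] by auto
  then have "a = 0" using assms(1) by (simp add: vec_eq_iff)
  then show False using assms(3) by blast
qed

lemma inner_V_op:
  assumes "\<forall>i. v i \<in> c0_space" "x \<in> l1_space"
  shows "a \<bullet> V_op v x = pairing (V_adj v a) x"
proof -
  have "a \<bullet> V_op v x = (\<Sum>i\<in>UNIV. \<Sum>j. a $ i * (v i j * x j))"
    using assms by (simp add: inner_vec_def V_op_def suminf_mult summable_pairing)
  also have "\<dots> = (\<Sum>j. \<Sum>i\<in>UNIV. a $ i * (v i j * x j))"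
    using assms by (intro suminf_sum[symmetric] summable_mult summable_pairing) auto
  also have "\<dots> = pairing (V_adj v a) x"
    by (simp add: pairing_def V_adj_def sum_distrib_right mult.assoc)
  finally show ?thesis .
qed

section \<open>Norm minimality yields a norming functional\<close>

lemma convex_image_l1_ball:
  assumes "\<forall>i. v i \<in> c0_space"
  shows "convex (V_op v ` {y \<in> l1_space. l1_norm y < r})"
proof (rule convexI)
  fix p q and s t :: real
  assume p: "p \<in> V_op v ` {y \<in> l1_space. l1_norm y < r}"
    and q: "q \<in> V_op v ` {y \<in> l1_space. l1_norm y < r}"
    and st: "0 \<le> s" "0 \<le> t" "s + t = 1"
  obtain x where x: "x \<in> l1_space" "l1_norm x < r" "p = V_op v x" using p by blast
  obtain y where y: "y \<in> l1_space" "l1_norm y < r" "q = V_op v y" using q by blast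
  let ?z = "s *\<^sub>R x + t *\<^sub>R y"
  have z: "?z \<in> l1_space" by (intro l1_space_add l1_space_scaleR x(1) y(1))
  have "l1_norm ?z \<le> s * l1_norm x + t * l1_norm y"
    using l1_norm_add_le[OF l1_space_scaleR[OF x(1)] l1_space_scaleR[OF y(1)], of s t] x y st
    by (simp add: l1_norm_scaleR)
  also have "\<dots> < r" using convex_bound_lt[OF x(2) y(2) st] .
  finally have "l1_norm ?z < r" .
  moreover have "V_op v ?z = s *\<^sub>R p + t *\<^sub>R q"
    using assms x y by (simp add: V_op_add V_op_scaleR l1_space_scaleR)
  ultimately show "s *\<^sub>R p + t *\<^sub>R q \<in> V_op v ` {y \<in> l1_space. l1_norm y < r}"
    using z by (metis (mono_tags, lifting) image_eqI mem_Collect_eq)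
qed

text \<open>
  The sup norm is detected by signed multiples of the unit sequences alone. In an open ball their
  norms are \<open>z * r\<close> with \<open>z < 1\<close>, and the bound at radius \<open>r\<close> follows in the limit \<open>z \<rightarrow> 1\<close>.
\<close>

lemma sup_norm_le_of_ball_bound:
  assumes "0 < r" and bound: "\<And>y. y \<in> l1_space \<Longrightarrow> l1_norm y < r \<Longrightarrow> pairing u y \<le> t"
  shows "r * sup_norm u \<le> t"
proof -
  have "\<bar>u j\<bar> \<le> t / r" for j
  proof -
    have "z * (r * \<bar>u j\<bar>) \<le> t" if z: "0 < z" "z < 1" for z
    proof -
      let ?y = "\<lambda>i. if i = j then z * r * sgn (u j) else 0"
      have "?y \<in> l1_space" by (rule finite_support_l1_space) (auto intro: finite_subset[of _ "{j}"])
      moreover have "l1_norm ?y < r"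
        using z assms(1) l1_norm_finite_support[of "{j}" ?y]
        by (cases "u j = 0") (auto simp: abs_mult abs_sgn_eq)
      ultimately have "pairing u ?y \<le> t" by (rule bound)
      moreover have "pairing u ?y = z * (r * \<bar>u j\<bar>)"
        using pairing_finite_support[of "{j}" ?y u] abs_sgn[of "u j"] by simp
      ultimately show ?thesis by simp
    qed
    then have "r * \<bar>u j\<bar> \<le> t" by (rule field_le_mult_one_interval)
    then show ?thesis using assms(1) by (simp add: field_simps)
  qed
  then have "sup_norm u \<le> t / r" by (rule sup_norm_le)
  then show ?thesis using assms(1) by (simp add: field_simps)
qed

text \<open>
  The certificate comes from separating \<open>V x\<close> from the image of the open ball whose radius is the
  norm of \<open>x\<close>. As the separation takes place in the finite-dimensional image space, the functional
  that it produces is a combination of the rows and not just a bounded sequence. Its sup norm is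
  normalized to the norm of \<open>x\<close> because the coefficients of the final representation have absolute
  values that sum to the norm of \<open>x\<close>.
\<close>

lemma dual_certificate:
  assumes c0: "\<forall>i. v i \<in> c0_space" and "inj v" "independent (range v)"
    and x: "x \<in> l1_space" "x \<noteq> 0"
    and min: "\<And>y. y \<in> l1_space \<Longrightarrow> V_op v y = V_op v x \<Longrightarrow> l1_norm x \<le> l1_norm y"
  obtains a where "a \<noteq> 0" "sup_norm (V_adj v a) = l1_norm x"
    "pairing (V_adj v a) x = sup_norm (V_adj v a) * l1_norm x"
proof -
  define r where "r = l1_norm x"
  have r: "0 < r" unfolding r_def by (rule l1_norm_pos[OF x])
  let ?B = "V_op v ` {y \<in> l1_space. l1_norm y < r}"
  have "0 \<in> {y \<in> l1_space. l1_norm y < r}"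
    using r by (simp add: l1_space_def l1_norm_def)
  then have "?B \<noteq> {}" by blast
  moreover have "?B \<inter> {V_op v x} = {}" using min by (force simp: r_def)
  ultimately obtain a b where a: "a \<noteq> 0" "\<forall>p\<in>?B. a \<bullet> p \<le> b" "b \<le> a \<bullet> V_op v x"
    using separating_hyperplane_sets[OF convex_image_l1_ball[OF c0] convex_singleton] by blast
  let ?w = "V_adj v a"
  have w: "?w \<in> c0_space" by (rule V_adj_c0_space[OF c0])
  have "pairing ?w y \<le> pairing ?w x" if "y \<in> l1_space" "l1_norm y < r" for y
    using a(2,3) that x(1) by (fastforce simp: inner_V_op[OF c0])
  then have "r * sup_norm ?w \<le> pairing ?w x" by (rule sup_norm_le_of_ball_bound[OF r])
  then have norming: "pairing ?w x = sup_norm ?w * r"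
    using pairing_le_norms[OF w x(1)] by (simp add: r_def mult.commute)
  have wpos: "0 < sup_norm ?w"
    using sup_norm_pos[OF w] V_adj_nonzero[OF assms(2,3) a(1)] by blast
  define c where "c = r / sup_norm ?w"
  have c: "0 < c" using r wpos by (simp add: c_def)
  show ?thesis
  proof (rule that[of "c *\<^sub>R a"])
    show "c *\<^sub>R a \<noteq> 0" using c a(1) by simp
    have s: "sup_norm (V_adj v (c *\<^sub>R a)) = c * sup_norm ?w"
      by (simp add: V_adj_scaleR sup_norm_scaleR[OF w c])
    then show "sup_norm (V_adj v (c *\<^sub>R a)) = l1_norm x"
      using wpos by (simp add: c_def r_def)
    show "pairing (V_adj v (c *\<^sub>R a)) x = sup_norm (V_adj v (c *\<^sub>R a)) * l1_norm x"
      unfolding s by (simp add: V_adj_scaleR pairing_scaleR_left[OF w x(1)] norming r_def)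
  qed
qed

section \<open>Extremality yields independent columns\<close>

text \<open>
  If two sequences have the same image under the operator, the fidelity terms agree, so the penalty
  alone decides.
\<close>

lemma solution_set_norm_minimal:
  assumes "x \<in> solution_set v q lam" "0 < lam" "y \<in> l1_space" "V_op v y = V_op v x"
  shows "l1_norm x \<le> l1_norm y"
  using assms by (auto simp: solution_set_def is_arg_min_def not_less)

lemma solution_set_same_value:
  assumes "x \<in> solution_set v q lam" "y \<in> l1_space" "V_op v y = V_op v x" "l1_norm y = l1_norm x"
  shows "y \<in> solution_set v q lam"
  using assms by (auto simp: solution_set_def is_arg_min_def)

text \<open>The hypothesis on \<open>s * t\<close> says that the signs of \<open>s\<close> and \<open>t\<close> do not conflict, and \<open>d\<close> is too
  small to reverse the sign of \<open>t\<close>.\<close>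

lemma norming_perturbation:
  fixes s t d e :: real
  assumes "s * t = \<bar>s\<bar> * \<bar>t\<bar>" "\<bar>d\<bar> \<le> \<bar>t\<bar>"
  shows "s * (t + d) = \<bar>s\<bar> * \<bar>t + d\<bar>"
  using assms by (cases "s = 0"; cases "t = 0") (auto simp: abs_if algebra_simps split: if_splits)

text \<open>
  Adding \<open>c\<close> reverses no sign of \<open>x\<close>, so \<open>V_adj v a\<close> still norms the perturbed sequence; as it
  vanishes on the kernel of the operator, the norm is unchanged.
\<close>

lemma l1_norm_kernel_perturbation:
  assumes c0: "\<forall>i. v i \<in> c0_space"
    and x: "x \<in> l1_space" and c: "c \<in> l1_space" "V_op v c = 0"
    and small: "\<And>j. \<bar>c j\<bar> \<le> \<bar>x j\<bar>"
    and norming: "pairing (V_adj v a) x = sup_norm (V_adj v a) * l1_norm x"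
    and pos: "0 < sup_norm (V_adj v a)"
  shows "l1_norm (x + c) = l1_norm x"
proof -
  let ?u = "V_adj v a"
  have u: "?u \<in> c0_space" by (rule V_adj_c0_space[OF c0])
  have "?u j * (x + c) j = sup_norm ?u * \<bar>(x + c) j\<bar>" for j
  proof (cases "x j = 0")
    case True
    then show ?thesis using small[of j] by simp
  next
    case False
    then have "\<bar>?u j\<bar> = sup_norm ?u"
      using holder_equality_peak[OF u x norming] by (simp add: peak_set_def)
    moreover have "?u j * x j = sup_norm ?u * \<bar>x j\<bar>"
      using holder_equality[OF u x] norming by blast
    ultimately show ?thesis using norming_perturbation[OF _ small[of j], of "?u j"] by simp
  qed
  then have "pairing ?u (x + c) = sup_norm ?u * l1_norm (x + c)"
    using holder_equality[OF u l1_space_add[OF x c(1)]] by blast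
  moreover have "pairing ?u c = 0" using inner_V_op[OF c0 c(1), of a] c(2) by simp
  ultimately have "sup_norm ?u * l1_norm (x + c) = sup_norm ?u * l1_norm x"
    using norming pairing_add_right[OF u x c(1)] by linarith
  then show ?thesis using pos by simp
qed

text \<open>
  A nonzero \<open>c\<close> in the kernel, scaled down, could be added to and subtracted from \<open>x\<close> within the
  solution set. Such a scaling exists because \<open>c\<close> lives on finitely many positions where \<open>x\<close> is
  nonzero.
\<close>

lemma extreme_point_kernel_trivial:
  assumes c0: "\<forall>i. v i \<in> c0_space"
    and ext: "x extreme_point_of solution_set v q lam"
    and norming: "pairing (V_adj v a) x = sup_norm (V_adj v a) * l1_norm x"
    and pos: "0 < sup_norm (V_adj v a)"
    and S: "finite S" "\<And>j. j \<in> S \<Longrightarrow> x j \<noteq> 0"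
    and c: "\<And>j. j \<notin> S \<Longrightarrow> c j = 0" "V_op v c = 0"
  shows "c = 0"
proof (rule ccontr)
  assume "c \<noteq> 0"
  have sol: "x \<in> solution_set v q lam" using ext by (simp add: extreme_point_of_def)
  then have x: "x \<in> l1_space" by (simp add: solution_set_def is_arg_min_def)
  have c1: "c \<in> l1_space"
    using S(1) c(1) by (intro finite_support_l1_space) (auto intro: finite_subset[of _ S])
  \<comment> \<open>The smallest nonzero \<open>|x j|\<close> bounds how far \<open>x\<close> can move without reversing signs;
    the extra 1 keeps the minimum defined for empty \<open>S\<close>.\<close>
  define m where "m = Min (insert 1 ((\<lambda>j. \<bar>x j\<bar>) ` S))"
  define C where "C = 1 + l1_norm c"
  have m: "0 < m" "\<And>j. j \<in> S \<Longrightarrow> m \<le> \<bar>x j\<bar>" using S by (auto simp: m_def)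
  have C: "0 < C" "\<bar>c j\<bar> \<le> C" for j
  proof -
    have "l1_norm c = (\<Sum>j\<in>S. \<bar>c j\<bar>)" by (rule l1_norm_finite_support[OF S(1) c(1)])
    moreover have "\<bar>c j\<bar> \<le> (\<Sum>j\<in>S. \<bar>c j\<bar>)"
      using S(1) c(1)[of j] member_le_sum[of j S "\<lambda>j. \<bar>c j\<bar>"] by (cases "j \<in> S") (auto intro: sum_nonneg)
    ultimately show "0 < C" "\<bar>c j\<bar> \<le> C" by (auto simp: C_def)
  qed
  define e where "e = m / C"
  have e: "0 < e" using m(1) C(1) by (simp add: e_def)
  have small: "\<bar>(s *\<^sub>R c) j\<bar> \<le> \<bar>x j\<bar>" if "\<bar>s\<bar> = e" for s j
  proof (cases "j \<in> S")
    case True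
    have "\<bar>(s *\<^sub>R c) j\<bar> \<le> e * C"
      using C(2)[of j] e that by (simp add: scaleR_fun_def abs_mult)
    also have "\<dots> = m" using C(1) by (simp add: e_def)
    finally show ?thesis using m(2)[OF True] by linarith
  qed (simp add: c(1) scaleR_fun_def)
  have perturbed: "x + s *\<^sub>R c \<in> solution_set v q lam" if "\<bar>s\<bar> = e" for s
  proof (rule solution_set_same_value[OF sol])
    have sc: "s *\<^sub>R c \<in> l1_space" and ker: "V_op v (s *\<^sub>R c) = 0"
      using c1 c(2) c0 by (auto simp: l1_space_scaleR V_op_scaleR)
    show "x + s *\<^sub>R c \<in> l1_space" by (rule l1_space_add[OF x sc])
    show "V_op v (x + s *\<^sub>R c) = V_op v x" using V_op_add[OF c0 x sc] ker by simp
    show "l1_norm (x + s *\<^sub>R c) = l1_norm x"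
      by (rule l1_norm_kernel_perturbation[OF c0 x sc ker small[OF that] norming pos])
  qed
  let ?p = "x + (- e) *\<^sub>R c" and ?q = "x + e *\<^sub>R c"
  have "?q - ?p = (2 * e) *\<^sub>R c" by (simp add: fun_eq_iff scaleR_fun_def)
  then have "?p \<noteq> ?q" using e \<open>c \<noteq> 0\<close> by (metis scaleR_eq_0_iff mult_eq_0_iff zero_neq_numeral less_irrefl right_minus_eq)
  moreover have "x = (1 - 1/2) *\<^sub>R ?p + (1/2) *\<^sub>R ?q"
    by (simp add: fun_eq_iff scaleR_fun_def field_simps)
  ultimately have "x \<in> open_segment ?p ?q"
    unfolding in_segment by (intro conjI exI[of _ "1/2"]) auto
  moreover have "?p \<in> solution_set v q lam" "?q \<in> solution_set v q lam"
    using perturbed[of "- e"] perturbed[of e] e by simp_all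
  ultimately show False using ext unfolding extreme_point_of_def by blast
qed

text \<open>
  Independence is assumed of the family \<open>f\<close>, which is stronger than independence of its image: two
  equal columns already give a relation, so \<open>f\<close> is injective and no columns are lost in the count.
\<close>

lemma card_le_dim_of_independent_family:
  fixes f :: "'a \<Rightarrow> 'b::euclidean_space"
  assumes "finite S" "S \<subseteq> T"
    and indep: "\<And>c. (\<Sum>k\<in>S. c k *\<^sub>R f k) = 0 \<Longrightarrow> \<forall>k\<in>S. c k = 0"
  shows "card S \<le> dim (span (f ` T))"
proof -
  have inj: "inj_on f S"
  proof (rule inj_onI, rule ccontr)
    fix k l assume kl: "k \<in> S" "l \<in> S" "f k = f l" "k \<noteq> l"
    let ?c = "\<lambda>i. if i = k then 1 else if i = l then -1 else (0::real)"
    have "(\<Sum>i\<in>S. ?c i *\<^sub>R f i) = (\<Sum>i\<in>{k,l}. ?c i *\<^sub>R f i)"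
      using kl assms(1) by (intro sum.mono_neutral_right) auto
    also have "\<dots> = 0" using kl by simp
    finally show False using indep[of ?c] kl(1) by auto
  qed
  have "independent (f ` S)"
  proof
    assume "dependent (f ` S)"
    then obtain d where d: "\<exists>w\<in>f ` S. d w \<noteq> 0" "(\<Sum>w\<in>f ` S. d w *\<^sub>R w) = 0"
      using dependent_finite[of "f ` S"] assms(1) by auto
    then have "(\<Sum>k\<in>S. d (f k) *\<^sub>R f k) = 0" using inj by (simp add: sum.reindex)
    then show False using indep[of "\<lambda>k. d (f k)"] d(1) by auto
  qed
  moreover have "f ` S \<subseteq> span (f ` T)" using assms(2) by (auto intro: span_base)
  ultimately have "card (f ` S) \<le> dim (span (f ` T))" by (rule independent_card_le_dim[rotated])
  then show ?thesis using card_image[OF inj] by simp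
qed

lemma mat_rank_peak_matrix:
  assumes "finite (peak_set u)"
  shows "mat_rank (peak_count u) (peak_matrix v u) =
    dim (span ((\<lambda>k. (\<chi> i. v i k) :: real^'n::finite) ` peak_set u))"
proof -
  let ?l = "sorted_list_of_set (peak_set u)"
  have peaks: "peak_set u = (!) ?l ` {..<peak_count u}"
    using nth_image[of "length ?l" ?l] assms by (simp add: peak_count_def lessThan_atLeast0)
  have "(\<lambda>k. (\<chi> i. v i k) :: real^'n) ` peak_set u =
      (\<lambda>j. \<chi> i. peak_matrix v u i j) ` {..<peak_count u}"
    by (subst peaks) (simp add: peak_matrix_def image_image)
  then show ?thesis by (simp add: mat_rank_def)
qed

lemma V_op_finite_support:
  assumes "finite S" "\<And>j. j \<notin> S \<Longrightarrow> c j = 0"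
  shows "V_op v c = (\<Sum>k\<in>S. c k *\<^sub>R (\<chi> i. v i k))"
  by (simp add: V_op_pairing vec_eq_iff pairing_finite_support[OF assms] mult.commute)

theorem theorem18:
  fixes v :: "'n::finite \<Rightarrow> nat \<Rightarrow> real"
    and y0 :: "real^'n"
    and Q :: "real^'n \<Rightarrow> real^'n \<Rightarrow> real"
    and lam :: real
    and xhat :: "nat \<Rightarrow> real"
  assumes "\<forall>i. v i \<in> c0_space"
    and "inj v" and "independent (range v)"
    and "lam > 0"
    and "\<forall>z. 0 \<le> Q y0 z"
    and "lower_semicontinuous (Q y0)"
    and "convex_on UNIV (Q y0)"
    and "xhat extreme_point_of solution_set v (Q y0) lam"
    and "xhat \<noteq> 0"
  shows "\<exists>vhat \<in> span (range v). vhat \<noteq> 0 \<and>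
    (\<exists>(M::nat) (\<alpha>::nat \<Rightarrow> real) (k::nat \<Rightarrow> nat).
      1 \<le> M \<and> M \<le> mat_rank (peak_count vhat) (peak_matrix v vhat) \<and>
      (\<forall>j\<in>{1..M}. \<alpha> j \<noteq> 0) \<and>
      (\<Sum>j=1..M. \<bar>\<alpha> j\<bar>) = sup_norm vhat \<and>
      (\<forall>j\<in>{1..M}. k j \<in> peak_set vhat) \<and>
      xhat = (\<Sum>j=1..M. \<alpha> j *\<^sub>R (\<lambda>i. K i (k j))))"
proof -
  have sol: "xhat \<in> solution_set v (Q y0) lam"
    using assms(8) by (simp add: extreme_point_of_def)
  then have x: "xhat \<in> l1_space" by (simp add: solution_set_def is_arg_min_def)
  obtain a where a: "a \<noteq> 0" "sup_norm (V_adj v a) = l1_norm xhat"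
    "pairing (V_adj v a) xhat = sup_norm (V_adj v a) * l1_norm xhat"
    using dual_certificate[OF assms(1-3) x assms(9)]
      solution_set_norm_minimal[OF sol assms(4)] by blast
  define u where "u = V_adj v a"
  note cert = a(2,3)[folded u_def]
  have u: "u \<in> c0_space" "u \<noteq> 0"
    using V_adj_c0_space[OF assms(1)] V_adj_nonzero[OF assms(2,3) a(1)] by (auto simp: u_def)
  define S where "S = {j. xhat j \<noteq> 0}"
  have S: "S \<subseteq> peak_set u" using holder_equality_peak[OF u(1) x cert(2)] by (auto simp: S_def)
  have finS: "finite S" by (rule finite_subset[OF S finite_peak_set[OF u]])
  have "S \<noteq> {}" using assms(9) by (auto simp: S_def fun_eq_iff)
  have rank: "card S \<le> mat_rank (peak_count u) (peak_matrix v u)"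
    unfolding mat_rank_peak_matrix[OF finite_peak_set[OF u]]
  proof (rule card_le_dim_of_independent_family[OF finS S])
    fix c :: "nat \<Rightarrow> real"
    assume rel: "(\<Sum>k\<in>S. c k *\<^sub>R (\<chi> i. v i k) :: real^'n) = 0"
    let ?c = "\<lambda>j. if j \<in> S then c j else 0"
    have "V_op v ?c = 0" using rel V_op_finite_support[OF finS, of ?c v] by simp
    then have "?c = 0"
      using extreme_point_kernel_trivial[OF assms(1,8) a(3) _ finS, of ?c]
        sup_norm_pos[OF u] by (auto simp: u_def S_def)
    then show "\<forall>k\<in>S. c k = 0" by (auto simp: fun_eq_iff split: if_splits)
  qed
  obtain k where k: "bij_betw k {1..card S} S"
    using ex_bij_betw_nat_finite_1[OF finS] by blast
  have pos: "1 \<le> card S" using finS \<open>S \<noteq> {}\<close> by (simp add: Suc_le_eq card_gt_0_iff)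
  have mem: "k j \<in> S" if "j \<in> {1..card S}" for j
    using k that by (auto simp: bij_betw_def)
  have norm: "(\<Sum>j=1..card S. \<bar>xhat (k j)\<bar>) = sup_norm u"
    using sum.reindex_bij_betw[OF k, of "\<lambda>i. \<bar>xhat i\<bar>"] cert(1)
      l1_norm_finite_support[OF finS, of xhat] by (simp add: S_def)
  have repr: "xhat = (\<Sum>j=1..card S. xhat (k j) *\<^sub>R (\<lambda>i. K i (k j)))"
  proof
    fix i
    have "(\<Sum>j=1..card S. xhat (k j) *\<^sub>R (\<lambda>i. K i (k j))) i = (\<Sum>s\<in>S. xhat s * K i s)"
      using sum.reindex_bij_betw[OF k, of "\<lambda>s. xhat s * K i s"]
      by (simp add: sum_scaleR_fun_apply)
    also have "\<dots> = (\<Sum>s\<in>S. if i = s then xhat s else 0)"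
      by (intro sum.cong) (auto simp: K_def)
    also have "\<dots> = xhat i" using finS by (simp add: S_def)
    finally show "xhat i = (\<Sum>j=1..card S. xhat (k j) *\<^sub>R (\<lambda>i. K i (k j))) i" by simp
  qed
  have span: "u \<in> span (range v)" unfolding u_def by (rule V_adj_in_span)
  have nonzero: "\<forall>j\<in>{1..card S}. xhat (k j) \<noteq> 0" using mem by (auto simp: S_def)
  have peak: "\<forall>j\<in>{1..card S}. k j \<in> peak_set u" using mem S by blast
  show ?thesis
    by (rule bexI[OF _ span], rule conjI[OF u(2)], rule exI[of _ "card S"],
        rule exI[of _ "\<lambda>j. xhat (k j)"], rule exI[of _ k],
        intro conjI pos rank nonzero norm peak repr)
qed

end
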